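(* Let $\Omega\subset\mathbb{R}^2$ be a bounded domain with smooth boundary, $\nu>0$, and let $f>0$ be a smooth potential function on $\Omega$. Let $(\mathbf{u},\rho,P)$ be a (smooth) steady-state solution of the inhomogeneous incompressible Navier--Stokes system with force $\nabla f$ and no-slip boundary condition, i.e. time-independent functions satisfying $$\rho(\mathbf{u}\cdot\nabla)\mathbf{u}=\nu\Delta\mathbf{u}-\nabla P-\rho\nabla f,\qquad (\mathbf{u}\cdot\nabla)\rho=0,\qquad \nabla\cdot\mathbf{u}=0\quad\text{in }\Omega,\qquad \mathbf{u}|_{\partial\Omega}=\mathbf{0}.$$ Then $(\mathbf{u},\rho,P)$ is a hydrostatic equilibrium: $(\mathbf{u},\rho,P)=(\mathbf{0},\rho_s,p_s)$, where $p_s$ and $\rho_s$ satisfy the hydrostatic balance $$\nabla p_s=-\rho_s\nabla f .$$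
   Context: Here $\mathbf{u}:\Omega\to\mathbb{R}^2$ is the velocity, $\rho$ the (scalar) density and $P$ the (scalar) pressure. The time-dependent system is $\rho\,\partial_t\mathbf{u}+\rho(\mathbf{u}\cdot\nabla)\mathbf{u}=\nu\Delta\mathbf{u}-\nabla P-\rho\nabla f$, $\partial_t\rho+(\mathbf{u}\cdot\nabla)\rho=0$, $\nabla\cdot\mathbf{u}=0$, with $\mathbf{u}|_{\partial\Omega}=\mathbf{0}$; a steady state is a solution with $\partial_t\mathbf{u}=0$ and $\partial_t\rho=0$. *)

theory Defs
  imports "HOL-Analysis.Analysis"
begin

definition partial :: "'n::finite \<Rightarrow> (real^'n \<Rightarrow> 'b::real_normed_vector) \<Rightarrow> real^'n \<Rightarrow> 'b"
  where "partial i g x = frechet_derivative g (at x) (axis i 1)"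

(* For a list of indices I = [i1, ..., ik], the expression foldr partial I g is the iterated
   partial derivative d_i1 ... d_ik g.  On an open set, being (Frechet) differentiable to
   every order is the same as being C-infinity, so continuity need not be required separately. *)
definition smooth_on :: "(real^'n::finite) set \<Rightarrow> (real^'n \<Rightarrow> 'b::real_normed_vector) \<Rightarrow> bool"
  where "smooth_on S g \<longleftrightarrow> open S \<and> (\<forall>I. \<forall>x\<in>S. foldr partial I g differentiable at x)"

(* C-infinity up to the boundary: every derivative on the open set S extends continuously to
   the closure.  The first conjunct says that the boundary values of g itself are the
   continuous ones.  The values of g off the closure are irrelevant. *)
definition smooth_up_to_boundary ::
    "(real^'n::finite) set \<Rightarrow> (real^'n \<Rightarrow> 'b::real_normed_vector) \<Rightarrow> bool"
  where "smooth_up_to_boundary S g \<longleftrightarrow>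
    continuous_on (closure S) g \<and> smooth_on S g \<and>
    (\<forall>I. \<exists>h. continuous_on (closure S) h \<and> (\<forall>x\<in>S. h x = foldr partial I g x))"

definition grad :: "(real^'n::finite \<Rightarrow> real) \<Rightarrow> real^'n \<Rightarrow> real^'n"
  where "grad g x = (\<chi> i. partial i g x)"

definition div_field :: "(real^'n::finite \<Rightarrow> real^'n) \<Rightarrow> real^'n \<Rightarrow> real"
  where "div_field u x = (\<Sum>i\<in>UNIV. partial i u x $ i)"

definition laplacian :: "(real^'n::finite \<Rightarrow> 'b::real_normed_vector) \<Rightarrow> real^'n \<Rightarrow> 'b"
  where "laplacian g x = (\<Sum>i\<in>UNIV. partial i (partial i g) x)"

(* (u . nabla) g, for scalar or vector-valued g *)
definition advect ::
    "(real^'n::finite \<Rightarrow> real^'n) \<Rightarrow> (real^'n \<Rightarrow> 'b::real_normed_vector) \<Rightarrow> real^'n \<Rightarrow> 'b"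
  where "advect u g x = (\<Sum>i\<in>UNIV. (u x $ i) *\<^sub>R partial i g x)"

(* Near each boundary point the set is the sublevel set of a smooth local defining function
   with nonvanishing gradient, i.e. it lies locally on one side of a smooth hypersurface. *)
definition smooth_boundary :: "(real^'n::finite) set \<Rightarrow> bool"
  where "smooth_boundary S \<longleftrightarrow>
    (\<forall>p\<in>frontier S. \<exists>U \<phi>. open U \<and> p \<in> U \<and> smooth_on U \<phi> \<and>
       (\<forall>x\<in>U. grad \<phi> x \<noteq> 0) \<and> S \<inter> U = {x\<in>U. \<phi> x < 0})"

definition bounded_smooth_domain :: "(real^'n::finite) set \<Rightarrow> bool"
  where "bounded_smooth_domain S \<longleftrightarrow>
    S \<noteq> {} \<and> open S \<and> connected S \<and> bounded S \<and> smooth_boundary S"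

definition steady_inhomogeneous_NS ::
    "(real^2) set \<Rightarrow> real \<Rightarrow> (real^2 \<Rightarrow> real) \<Rightarrow>
     (real^2 \<Rightarrow> real^2) \<Rightarrow> (real^2 \<Rightarrow> real) \<Rightarrow> (real^2 \<Rightarrow> real) \<Rightarrow> bool"
  where "steady_inhomogeneous_NS \<Omega> \<nu> f u \<rho> P \<longleftrightarrow>
    (\<forall>x\<in>\<Omega>. \<rho> x *\<^sub>R advect u u x = \<nu> *\<^sub>R laplacian u x - grad P x - \<rho> x *\<^sub>R grad f x) \<and>
    (\<forall>x\<in>\<Omega>. advect u \<rho> x = 0) \<and>
    (\<forall>x\<in>\<Omega>. div_field u x = 0) \<and>
    (\<forall>x\<in>frontier \<Omega>. u x = 0)"

definition hydrostatic_equilibrium ::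
    "(real^2) set \<Rightarrow> (real^2 \<Rightarrow> real) \<Rightarrow>
     (real^2 \<Rightarrow> real^2) \<Rightarrow> (real^2 \<Rightarrow> real) \<Rightarrow> (real^2 \<Rightarrow> real) \<Rightarrow> bool"
  where "hydrostatic_equilibrium \<Omega> f u \<rho> P \<longleftrightarrow>
    (\<forall>x\<in>closure \<Omega>. u x = 0) \<and>
    (\<forall>x\<in>\<Omega>. grad P x = - (\<rho> x *\<^sub>R grad f x))"

end

theory Submission imports Defs begin

text \<open>
  Taking the inner product of the momentum equation with u and using transport and
  incompressibility gives the pointwise energy identity
  \<open>div F = \<nu> |\<nabla>u|\<^sup>2\<close> with the flux
  \<open>F\<^sub>i = \<nu> \<Sum>\<^sub>j u\<^sub>j \<partial>\<^sub>i u\<^sub>j - (P + \<rho> (f + |u|\<^sup>2 / 2)) u\<^sub>i\<close>.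
  Since F vanishes on the boundary, its divergence integrates to 0, so u is constant, hence 0,
  and the momentum equation reduces to hydrostatic balance.
\<close>

section \<open>Functions of one real variable that vanish off an open set\<close>

text \<open>Starting from \<open>a\<close> in \<open>T\<close>, the mean value theorem is applied
  only up to the first exit from \<open>T\<close>, where \<open>g\<close> is already 0. Nothing is
  asked of the derivative outside \<open>T\<close>, where the extension by zero used below may have
  a kink.\<close>

lemma abs_le_of_zero_off_open:
  fixes g :: "real \<Rightarrow> real"
  assumes cont: "continuous_on UNIV g" and T: "open T"
    and zero: "\<And>s. s \<notin> T \<Longrightarrow> g s = 0"
    and deriv: "\<And>s. s \<in> T \<Longrightarrow> (g has_real_derivative d s) (at s)"
    and bound: "\<And>s. s \<in> T \<Longrightarrow> \<bar>d s\<bar> \<le> M"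
    and "0 \<le> M" "a \<le> c" "c \<notin> T"
  shows "\<bar>g a\<bar> \<le> M * (c - a)"
proof (cases "a \<in> T")
  case False
  then show ?thesis using zero assms by simp
next
  case True
  let ?K = "{a..c} - T"
  have K: "compact ?K" using T by (simp add: compact_diff)
  have "c \<in> ?K" using assms by auto
  \<comment> \<open>\<open>b\<close> is the first point of \<open>{a..c}\<close> outside
    \<open>T\<close>: \<open>g b = 0\<close>, and everything strictly between \<open>a\<close> and
    \<open>b\<close> lies in \<open>T\<close>.\<close>
  then obtain b where b: "b \<in> ?K" "\<And>y. y \<in> ?K \<Longrightarrow> b \<le> y"
    using compact_attains_inf[OF K] by blast
  have ab: "a < b" using b(1) True by (cases "a = b") auto
  have inT: "s \<in> T" if "a < s" "s < b" for s
    using that b(1) b(2)[of s] by (auto simp: not_le[symmetric])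
  have "\<exists>z. a < z \<and> z < b \<and> g b - g a = (b - a) * d z"
  proof -
    obtain l z where z: "a < z" "z < b" "(g has_real_derivative l) (at z)" "g b - g a = (b - a) * l"
      using MVT[OF ab, of g] cont deriv inT
      by (metis continuous_on_subset subset_UNIV real_differentiable_def)
    then show ?thesis using deriv[OF inT[OF z(1,2)]] DERIV_unique by blast
  qed
  then obtain z where z: "a < z" "z < b" "g b - g a = (b - a) * d z" by blast
  have "\<bar>g a\<bar> = (b - a) * \<bar>d z\<bar>"
    using z(3) zero[of b] b(1) ab by (simp add: abs_mult abs_minus_commute[of _ 0] flip: abs_minus_cancel[of "g a"])
  also have "\<dots> \<le> (b - a) * M" using bound[OF inT[OF z(1,2)]] ab by simp
  also have "\<dots> \<le> M * (c - a)" using b(1) \<open>0 \<le> M\<close> by (simp add: mult.commute mult_left_mono)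
  finally show ?thesis .
qed

text \<open>Either the mean value theorem works on all of \<open>{a..b}\<close>, or the interval
  contains a zero \<open>c\<close> outside \<open>T\<close>. In the second case \<open>g a\<close>
  and \<open>g b\<close> are bounded by \<open>M\<close> times their distances to \<open>c\<close>,
  and these distances add up to \<open>b - a\<close>.\<close>

lemma lipschitz_of_zero_off_open:
  fixes g :: "real \<Rightarrow> real"
  assumes cont: "continuous_on UNIV g" and T: "open T"
    and zero: "\<And>s. s \<notin> T \<Longrightarrow> g s = 0"
    and deriv: "\<And>s. s \<in> T \<Longrightarrow> (g has_real_derivative d s) (at s)"
    and bound: "\<And>s. s \<in> T \<Longrightarrow> \<bar>d s\<bar> \<le> M"
    and M: "0 \<le> M" and ab: "a < b"
  shows "\<bar>g b - g a\<bar> \<le> M * (b - a)"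
proof (cases "{a..b} \<subseteq> T")
  case True
  then have "\<exists>z. a < z \<and> z < b \<and> g b - g a = (b - a) * d z"
    by (intro MVT2[OF ab] deriv) auto
  then obtain z where z: "a < z" "z < b" "g b - g a = (b - a) * d z" by blast
  then have "\<bar>d z\<bar> \<le> M" using True by (intro bound) auto
  then show ?thesis using z ab by (simp add: abs_mult mult.commute mult_right_mono)
next
  case False
  then obtain c where c: "a \<le> c" "c \<le> b" "c \<notin> T"
    by (auto simp: subset_iff)
  have 1: "\<bar>g a\<bar> \<le> M * (c - a)"
    by (rule abs_le_of_zero_off_open[OF cont T zero deriv bound M c(1,3)])
  \<comment> \<open>The one-sided estimate wants the zero to the right of the point, so for
    \<open>b\<close> it is applied to the reflected function.\<close>
  have "\<bar>(g \<circ> uminus) (- b)\<bar> \<le> M * (- c - (- b))"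
  proof (rule abs_le_of_zero_off_open[where T = "uminus ` T" and d = "\<lambda>s. - d (- s)"])
    show "continuous_on UNIV (g \<circ> uminus)"
      by (intro continuous_on_compose continuous_intros continuous_on_subset[OF cont]) auto
    show "(g \<circ> uminus has_real_derivative - d (- s)) (at s)" if "s \<in> uminus ` T" for s
      using that deriv[of "- s"] by (auto simp: DERIV_mirror o_def)
  qed (use T zero bound M c in \<open>force simp: open_negations image_iff\<close>)+
  then have 2: "\<bar>g b\<bar> \<le> M * (b - c)" by (simp add: algebra_simps)
  have "M * (c - a) + M * (b - c) = M * (b - a)" by (simp add: algebra_simps)
  then show ?thesis using 1 2 by linarith
qed

section \<open>Integrals of directional derivatives\<close>

text \<open>A directional derivative is given at parameter 0 for each base point; moving the base
  point along the line turns this into a derivative at every parameter \<open>s\<close>.\<close>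

lemma line_derivative_shift:
  fixes e :: "'a::real_normed_vector"
  assumes "((\<lambda>t. h (x + s *\<^sub>R e + t *\<^sub>R e)) has_real_derivative D) (at 0)"
  shows "((\<lambda>t. h (x + t *\<^sub>R e)) has_real_derivative D) (at s)"
  using assms DERIV_shift[of "\<lambda>t. h (x + t *\<^sub>R e)" D 0 s]
  by (simp add: algebra_simps)

text \<open>
  No boundary regularity is needed: extend h by 0 to a function G that is Lipschitz along e.
  By translation invariance, the integral over S of the difference quotient of G with step t
  is minus the integral of G / t over the points of S that a shift by \<open>- t e\<close>
  moves out of S. There \<open>|G| \<le> M t\<close>, and every point of the open set S leaves
  this layer as t tends to 0.
\<close>
theorem integral_directional_derivative_eq_0:
  fixes h :: "'a::euclidean_space \<Rightarrow> real"
  assumes S: "open S" "bounded S"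
    and cont: "continuous_on (closure S) h"
    and zero: "\<And>x. x \<in> frontier S \<Longrightarrow> h x = 0"
    and deriv: "\<And>x. x \<in> S \<Longrightarrow> ((\<lambda>t. h (x + t *\<^sub>R e)) has_real_derivative d x) (at 0)"
    and bound: "bounded (d ` S)"
  shows "integrable lborel (\<lambda>x. indicator S x * d x)"
    and "(\<integral>x. indicator S x * d x \<partial>lborel) = 0"
proof -
  define G where "G x = (if x \<in> S then h x else 0)" for x
  have contG: "continuous_on UNIV G"
  proof -
    \<comment> \<open>Both pieces are closed, they meet in the frontier of \<open>S\<close>, and
      there \<open>h\<close> agrees with 0.\<close>
    have "continuous_on (closure S \<union> - S) G"
      unfolding G_def
      using S zero by (intro continuous_on_If cont) (auto simp: frontier_def interior_open)
    moreover have "closure S \<union> - S = UNIV" using closure_subset by auto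
    ultimately show ?thesis by simp
  qed
  have Gborel[measurable]: "G \<in> borel_measurable borel"
    using contG by (rule borel_measurable_continuous_onI)
  have Sborel[measurable]: "S \<in> sets borel" using S by simp
  obtain M where M: "0 \<le> M" "\<And>x. x \<in> S \<Longrightarrow> \<bar>d x\<bar> \<le> M"
    using bound unfolding bounded_pos by (auto intro: less_imp_le)
  have derivG: "((\<lambda>t. G (x + t *\<^sub>R e)) has_real_derivative d x) (at 0)" if "x \<in> S" for x
  proof (rule has_field_derivative_transform_within_open[OF deriv[OF that]])
    show "open ((\<lambda>t. x + t *\<^sub>R e) -` S)"
      by (intro open_vimage S continuous_intros)
  qed (use that in \<open>auto simp: G_def\<close>)
  have lip: "\<bar>G (x + t *\<^sub>R e) - G x\<bar> \<le> M * t" if "0 < t" for x t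
  proof -
    have "\<bar>G (x + t *\<^sub>R e) - G (x + 0 *\<^sub>R e)\<bar> \<le> M * (t - 0)"
    proof (rule lipschitz_of_zero_off_open[where g = "\<lambda>s. G (x + s *\<^sub>R e)"
          and T = "(\<lambda>s. x + s *\<^sub>R e) -` S" and d = "\<lambda>s. d (x + s *\<^sub>R e)"])
      show "continuous_on UNIV (\<lambda>s. G (x + s *\<^sub>R e))"
        by (intro continuous_on_compose2[OF contG] continuous_intros) auto
      show "open ((\<lambda>s. x + s *\<^sub>R e) -` S)"
        by (intro open_vimage S continuous_intros)
      show "((\<lambda>s. G (x + s *\<^sub>R e)) has_real_derivative d (x + s *\<^sub>R e)) (at s)"
        if "s \<in> (\<lambda>s. x + s *\<^sub>R e) -` S" for s
        by (rule line_derivative_shift, rule derivG) (use that in auto)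
    qed (use M that in \<open>auto simp: G_def\<close>)
    then show ?thesis by simp
  qed
  \<comment> \<open>Positive steps tending to 0, taken as a sequence so that dominated convergence
    applies.\<close>
  define t where "t n = 1 / real (Suc n)" for n
  have t: "0 < t n" for n by (simp add: t_def)
  have t0: "t \<longlonglongrightarrow> 0" unfolding t_def by (rule LIMSEQ_Suc[OF lim_1_over_n])
  define Q where "Q n x = indicator S x * ((G (x + t n *\<^sub>R e) - G x) / t n)" for n x
  \<comment> \<open>\<open>J n\<close> lives on the boundary layer; the restriction to
    \<open>x\<close> in \<open>S\<close> is implicit because \<open>G\<close> vanishes
    elsewhere.\<close>
  define J where "J n x = indicator (- S) (x - t n *\<^sub>R e) * G x / t n" for n x
  \<comment> \<open>The common dominating function for \<open>Q n\<close> and \<open>J n\<close>,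
    integrable because \<open>S\<close> is bounded.\<close>
  have intS: "integrable lborel (\<lambda>x. M * indicator S x)"
    using emeasure_bounded_finite[OF S(2)] by (intro integrable_mult_right integrable_real_indicator) auto
  have limQ: "(\<lambda>n. Q n x) \<longlonglongrightarrow> indicator S x * d x" for x
  proof (cases "x \<in> S")
    case True
    have "((\<lambda>s. (G (x + s *\<^sub>R e) - G x) / s) \<longlongrightarrow> d x) (at 0)"
      using derivG[OF True] by (simp add: has_field_derivative_iff)
    moreover have "filterlim t (at 0) sequentially"
      unfolding filterlim_at using t0 t by (auto intro!: always_eventually simp: less_imp_neq[symmetric])
    ultimately have "(\<lambda>n. (G (x + t n *\<^sub>R e) - G x) / t n) \<longlonglongrightarrow> d x"
      by (rule filterlim_compose)
    then show ?thesis using True by (simp add: Q_def)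
  qed (simp add: Q_def)
  have measQ[measurable]: "Q n \<in> borel_measurable lborel" for n
    unfolding Q_def by measurable
  \<comment> \<open>Measurability of \<open>d\<close> is inherited from the difference quotients
    through their pointwise limit.\<close>
  have measd: "(\<lambda>x. indicator S x * d x) \<in> borel_measurable lborel"
    by (rule borel_measurable_LIMSEQ_real[OF limQ measQ])
  have boundQ: "AE x in lborel. norm (Q n x) \<le> M * indicator S x" for n
    using lip[OF t[of n]] t[of n] by (auto simp: Q_def field_simps split: split_indicator)
  show "integrable lborel (\<lambda>x. indicator S x * d x)"
    by (rule integrable_dominated_convergence[OF measd measQ intS AE_I2[OF limQ] boundQ])
  have intQ: "(\<lambda>n. integral\<^sup>L lborel (Q n)) \<longlonglongrightarrow> (\<integral>x. indicator S x * d x \<partial>lborel)"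
    by (rule integral_dominated_convergence[OF measd measQ intS AE_I2[OF limQ] boundQ])
  have measJ[measurable]: "J n \<in> borel_measurable lborel" for n
    unfolding J_def by measurable
  have boundJ: "AE x in lborel. norm (J n x) \<le> M * indicator S x" for n
  proof (rule AE_I2)
    fix x
    show "norm (J n x) \<le> M * indicator S x"
    proof (cases "x \<in> S \<and> x - t n *\<^sub>R e \<notin> S")
      case True
      \<comment> \<open>The shifted point is outside \<open>S\<close>, so \<open>G\<close> is 0
        there and the Lipschitz estimate bounds \<open>G x\<close> itself.\<close>
      then have "\<bar>G x\<bar> \<le> M * t n"
        using lip[OF t[of n], of "x - t n *\<^sub>R e"] by (simp add: G_def)
      then show ?thesis using True t[of n] by (simp add: J_def field_simps)
    next
      case False
      then show ?thesis using M by (auto simp: J_def G_def split: split_indicator)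
    qed
  qed
  have limJ: "(\<lambda>n. J n x) \<longlonglongrightarrow> 0" for x
  proof (cases "x \<in> S")
    case True
    have "(\<lambda>n. x - t n *\<^sub>R e) \<longlonglongrightarrow> x - 0 *\<^sub>R e" by (intro tendsto_intros t0)
    then have "eventually (\<lambda>n. x - t n *\<^sub>R e \<in> S) sequentially"
      using True S by (intro topological_tendstoD) auto
    then have "eventually (\<lambda>n. J n x = 0) sequentially"
      by (rule eventually_mono) (simp add: J_def)
    then show ?thesis by (rule tendsto_eventually)
  qed (simp add: J_def G_def)
  have intJ: "(\<lambda>n. integral\<^sup>L lborel (J n)) \<longlonglongrightarrow> (\<integral>x. 0 \<partial>(lborel :: 'a measure))"
    by (rule integral_dominated_convergence[OF borel_measurable_const measJ intS AE_I2[OF limJ] boundJ])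
  have intG: "integrable lborel G"
  proof -
    have "integrable lborel (\<lambda>x. indicator (closure S) x *\<^sub>R G x)"
      using S by (intro borel_integrable_compact continuous_on_subset[OF contG]) auto
    moreover have "(\<lambda>x. indicator (closure S) x *\<^sub>R G x) = G"
      using closure_subset[of S] by (auto simp: G_def fun_eq_iff split: split_indicator)
    ultimately show ?thesis by simp
  qed
  have "integral\<^sup>L lborel (Q n) = - integral\<^sup>L lborel (J n)" for n
  proof -
    have i1: "integrable lborel (\<lambda>y. indicator S (y - t n *\<^sub>R e) * G y / t n)"
      by (rule Bochner_Integration.integrable_bound[OF integrable_divide[OF intG, of "t n"]])
         (auto split: split_indicator)
    have i2: "integrable lborel (\<lambda>x. indicator S x * G (x + t n *\<^sub>R e) / t n)"
      using i1 integrable_distr[of "(+) (t n *\<^sub>R e)" lborel borel "\<lambda>y. indicator S (y - t n *\<^sub>R e) * G y / t n"]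
      by (simp add: lborel_distr_plus add.commute)
    have "integral\<^sup>L lborel (Q n) = (\<integral>x. indicator S x * G (x + t n *\<^sub>R e) / t n - G x / t n \<partial>lborel)"
      by (rule Bochner_Integration.integral_cong)
         (auto simp: Q_def G_def diff_divide_distrib split: split_indicator)
    also have "\<dots> = (\<integral>x. indicator S x * G (x + t n *\<^sub>R e) / t n \<partial>lborel) - (\<integral>x. G x / t n \<partial>lborel)"
      using i2 intG by (intro Bochner_Integration.integral_diff) auto
    also have "(\<integral>x. indicator S x * G (x + t n *\<^sub>R e) / t n \<partial>lborel)
        = (\<integral>y. indicator S (y - t n *\<^sub>R e) * G y / t n \<partial>distr lborel borel ((+) (t n *\<^sub>R e)))"
      by (subst integral_distr) (auto simp: add.commute)
    also have "\<dots> = (\<integral>y. indicator S (y - t n *\<^sub>R e) * G y / t n \<partial>lborel)"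
      by (simp add: lborel_distr_plus)
    also have "\<dots> - (\<integral>x. G x / t n \<partial>lborel)
        = (\<integral>y. indicator S (y - t n *\<^sub>R e) * G y / t n - G y / t n \<partial>lborel)"
      using i1 intG by (intro Bochner_Integration.integral_diff[symmetric]) auto
    \<comment> \<open>At the point \<open>y - t n *\<^sub>R e\<close>, the indicator of
      \<open>S\<close> minus 1 is minus the indicator of the complement.\<close>
    also have "\<dots> = (\<integral>y. - J n y \<partial>lborel)"
      by (rule Bochner_Integration.integral_cong) (auto simp: J_def split: split_indicator)
    finally show ?thesis by simp
  qed
  then have "(\<lambda>n. integral\<^sup>L lborel (Q n)) \<longlonglongrightarrow> 0"
    using tendsto_minus[OF intJ] by simp
  then show "(\<integral>x. indicator S x * d x \<partial>lborel) = 0"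
    using intQ LIMSEQ_unique by blast
qed

text \<open>The integrand vanishes almost everywhere, so the open set where \<open>g\<close> is
  nonzero is null; a nonempty open set never is.\<close>

lemma continuous_eq_0_if_integral_eq_0:
  fixes g :: "'a::euclidean_space \<Rightarrow> real"
  assumes S: "open S" and cont: "continuous_on S g" and nonneg: "\<And>x. x \<in> S \<Longrightarrow> 0 \<le> g x"
    and int: "integrable lborel (\<lambda>x. indicator S x * g x)"
    and zero: "(\<integral>x. indicator S x * g x \<partial>lborel) = 0"
    and x: "x \<in> S"
  shows "g x = 0"
proof (rule ccontr)
  assume "g x \<noteq> 0"
  let ?T = "S \<inter> g -` (- {0})"
  have T: "open ?T" using S cont by (simp add: continuous_open_preimage open_delete Compl_eq_Diff_UNIV)
  have "AE y in lborel. indicator S y * g y = 0"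
    using integral_nonneg_eq_0_iff_AE[OF int] zero nonneg by (auto split: split_indicator)
  then have "AE y in lborel. y \<notin> ?T" by eventually_elim auto
  then have "?T \<in> null_sets lborel"
    using T by (subst AE_iff_null_sets) auto
  then have "negligible ?T"
    by (simp add: negligible_iff_null_sets null_sets_completionI)
  then show False using open_not_negligible[OF T] \<open>g x \<noteq> 0\<close> x by blast
qed

section \<open>Partial derivatives and smoothness up to the boundary\<close>

text \<open>The chain rule along a coordinate line. It links \<open>partial\<close> to the
  one-variable derivatives in which the integral theorem is phrased.\<close>

lemma has_vector_derivative_partial:
  assumes "g differentiable at x"
  shows "((\<lambda>t. g (x + t *\<^sub>R axis i 1)) has_vector_derivative partial i g x) (at 0)"
proof -
  have D: "(g has_derivative frechet_derivative g (at x)) (at (x + 0 *\<^sub>R axis i 1))"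
    using assms by (simp add: frechet_derivative_works)
  have "((\<lambda>t. x + t *\<^sub>R axis i 1) has_derivative (\<lambda>t. t *\<^sub>R axis i 1)) (at 0)"
    by (auto intro!: derivative_eq_intros)
  from diff_chain_at[OF this D] show ?thesis
    using linear_frechet_derivative[OF assms]
    by (simp add: has_vector_derivative_def o_def partial_def linear_scale)
qed

lemma has_real_derivative_partial:
  assumes "g differentiable at x"
  shows "((\<lambda>t. g (x + t *\<^sub>R axis i 1)) has_real_derivative partial i g x) (at 0)"
  using has_vector_derivative_partial[OF assms]
  by (simp add: has_real_derivative_iff_has_vector_derivative)

lemma has_real_derivative_partial_nth:
  fixes g :: "real^'n::finite \<Rightarrow> real^'m::finite"
  assumes "g differentiable at x"
  shows "((\<lambda>t. g (x + t *\<^sub>R axis i 1) $ j) has_real_derivative partial i g x $ j) (at 0)"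
  using bounded_linear.has_vector_derivative[OF bounded_linear_vec_nth has_vector_derivative_partial[OF assms]]
  by (simp add: has_real_derivative_iff_has_vector_derivative)

lemma partial_eq_0_if_zero_on_open:
  assumes "open S" "x \<in> S" "\<And>y. y \<in> S \<Longrightarrow> g y = 0"
  shows "partial i g x = 0"
proof -
  have "(g has_derivative (\<lambda>_. 0)) (at x)"
    by (rule has_derivative_transform_within_open[OF has_derivative_const assms(1,2)]) (use assms in auto)
  then show ?thesis by (simp add: partial_def flip: frechet_derivative_at)
qed

text \<open>The Frechet derivative is linear, hence determined by its values on the coordinate
  vectors.\<close>

lemma has_derivative_0_if_partial_eq_0:
  fixes g :: "real^'n::finite \<Rightarrow> 'b::real_normed_vector"
  assumes "g differentiable at x" "\<And>i. partial i g x = 0"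
  shows "(g has_derivative (\<lambda>_. 0)) (at x)"
proof -
  have "frechet_derivative g (at x) = (\<lambda>_. 0)"
  proof (rule linear_eq_stdbasis)
    show "linear (frechet_derivative g (at x))" by (rule linear_frechet_derivative[OF assms(1)])
    show "frechet_derivative g (at x) b = 0" if "b \<in> Basis" for b
      using that assms(2) by (auto simp: Basis_vec_def partial_def)
  qed (simp add: linear_iff)
  then show ?thesis using assms(1) by (metis frechet_derivative_works)
qed

text \<open>The instances of the definition for the index lists \<open>[]\<close>,
  \<open>[i]\<close> and \<open>[i, i]\<close>, which is all the regularity that the energy argument
  draws on.\<close>

lemma smooth_up_to_boundaryD:
  assumes "smooth_up_to_boundary S g"
  shows "continuous_on (closure S) g"
    and "x \<in> S \<Longrightarrow> g differentiable at x"
    and "x \<in> S \<Longrightarrow> partial i g differentiable at x"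
    and "\<exists>h. continuous_on (closure S) h \<and> (\<forall>x\<in>S. h x = partial i g x)"
    and "\<exists>h. continuous_on (closure S) h \<and> (\<forall>x\<in>S. h x = partial i (partial i g) x)"
proof -
  note * = assms[unfolded smooth_up_to_boundary_def smooth_on_def]
  show "continuous_on (closure S) g" using * by blast
  show "x \<in> S \<Longrightarrow> g differentiable at x"
    using *[THEN conjunct2, THEN conjunct1, THEN conjunct2, rule_format, of x "[]"] by simp
  show "x \<in> S \<Longrightarrow> partial i g differentiable at x"
    using *[THEN conjunct2, THEN conjunct1, THEN conjunct2, rule_format, of x "[i]"] by simp
  show "\<exists>h. continuous_on (closure S) h \<and> (\<forall>x\<in>S. h x = partial i g x)"
    using *[THEN conjunct2, THEN conjunct2, rule_format, of "[i]"] by simp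
  show "\<exists>h. continuous_on (closure S) h \<and> (\<forall>x\<in>S. h x = partial i (partial i g) x)"
    using *[THEN conjunct2, THEN conjunct2, rule_format, of "[i, i]"] by simp
qed

section \<open>The energy flux and its consequences\<close>

text \<open>\<open>d i\<close> is the derivative of the \<open>i\<close>-th flux component in
  direction \<open>i\<close>, expanded by the product rule. The equations of motion do not enter
  yet: only regularity and the no-slip condition make the integral vanish.\<close>

lemma integral_energy_flux_eq_0:
  fixes u :: "real^2 \<Rightarrow> real^2" and f \<rho> P :: "real^2 \<Rightarrow> real" and \<nu> :: real
  assumes S: "open S" "bounded S"
    and f: "smooth_up_to_boundary S f" and u: "smooth_up_to_boundary S u"
    and \<rho>: "smooth_up_to_boundary S \<rho>" and P: "smooth_up_to_boundary S P"
    and u0: "\<And>x. x \<in> frontier S \<Longrightarrow> u x = 0"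
  defines "d \<equiv> \<lambda>i x.
      \<nu> * (\<Sum>j\<in>UNIV. (partial i u x $ j)\<^sup>2 + u x $ j * partial i (partial i u) x $ j)
      - (partial i P x + partial i \<rho> x * (f x + (\<Sum>j\<in>UNIV. (u x $ j)\<^sup>2) / 2)
          + \<rho> x * (partial i f x + (\<Sum>j\<in>UNIV. u x $ j * partial i u x $ j))) * u x $ i
      - (P x + \<rho> x * (f x + (\<Sum>j\<in>UNIV. (u x $ j)\<^sup>2) / 2)) * partial i u x $ i"
  shows "integrable lborel (\<lambda>x. indicator S x * d i x)"
    and "(\<integral>x. indicator S x * d i x \<partial>lborel) = 0"
proof -
  obtain v where v: "continuous_on (closure S) v" "\<And>x. x \<in> S \<Longrightarrow> v x = partial i u x"
    using smooth_up_to_boundaryD(4)[OF u] by blast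
  obtain w where w: "continuous_on (closure S) w" "\<And>x. x \<in> S \<Longrightarrow> w x = partial i (partial i u) x"
    using smooth_up_to_boundaryD(5)[OF u] by blast
  obtain fi where fi: "continuous_on (closure S) fi" "\<And>x. x \<in> S \<Longrightarrow> fi x = partial i f x"
    using smooth_up_to_boundaryD(4)[OF f] by blast
  obtain ri where ri: "continuous_on (closure S) ri" "\<And>x. x \<in> S \<Longrightarrow> ri x = partial i \<rho> x"
    using smooth_up_to_boundaryD(4)[OF \<rho>] by blast
  obtain Pi where Pi: "continuous_on (closure S) Pi" "\<And>x. x \<in> S \<Longrightarrow> Pi x = partial i P x"
    using smooth_up_to_boundaryD(4)[OF P] by blast
  note conts = v(1) w(1) fi(1) ri(1) Pi(1) smooth_up_to_boundaryD(1)[OF f]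
    smooth_up_to_boundaryD(1)[OF u] smooth_up_to_boundaryD(1)[OF \<rho>] smooth_up_to_boundaryD(1)[OF P]
  \<comment> \<open>The flux must be continuous on the closure, where \<open>partial i u\<close>
    itself is uncontrolled, so the continuous extension \<open>v\<close> takes its place. The
    parameter allows the same formula to be used with \<open>partial i u\<close> when
    differentiating inside \<open>S\<close>.\<close>
  define F where "F v x = \<nu> * (\<Sum>j\<in>UNIV. u x $ j * v x $ j)
      - (P x + \<rho> x * (f x + (\<Sum>j\<in>UNIV. (u x $ j)\<^sup>2) / 2)) * u x $ i" for v :: "real^2 \<Rightarrow> real^2" and x
  define d' where "d' x = \<nu> * (\<Sum>j\<in>UNIV. (v x $ j)\<^sup>2 + u x $ j * w x $ j)
      - (Pi x + ri x * (f x + (\<Sum>j\<in>UNIV. (u x $ j)\<^sup>2) / 2)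
          + \<rho> x * (fi x + (\<Sum>j\<in>UNIV. u x $ j * v x $ j))) * u x $ i
      - (P x + \<rho> x * (f x + (\<Sum>j\<in>UNIV. (u x $ j)\<^sup>2) / 2)) * v x $ i" for x
  have contF: "continuous_on (closure S) (F v)"
    unfolding F_def by (intro continuous_intros conts) auto
  have contd': "continuous_on (closure S) d'"
    unfolding d'_def by (intro continuous_intros conts) auto
  \<comment> \<open>\<open>d'\<close> is a continuous extension of \<open>d i\<close> to a compact
    set, which gives the bound required of the derivative.\<close>
  have "bounded (d' ` closure S)"
    using S by (intro compact_imp_bounded compact_continuous_image[OF contd']) auto
  moreover have "d i ` S \<subseteq> d' ` closure S"
    using closure_subset[of S] by (force simp: d_def d'_def v w fi ri Pi)
  ultimately have bound: "bounded (d i ` S)" by (rule bounded_subset)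
  have deriv: "((\<lambda>t. F v (x + t *\<^sub>R axis i 1)) has_real_derivative d i x) (at 0)" if x: "x \<in> S" for x
  proof -
    note D = has_real_derivative_partial_nth[OF smooth_up_to_boundaryD(2)[OF u x]]
      has_real_derivative_partial_nth[OF smooth_up_to_boundaryD(3)[OF u x]]
      has_real_derivative_partial[OF smooth_up_to_boundaryD(2)[OF f x]]
      has_real_derivative_partial[OF smooth_up_to_boundaryD(2)[OF \<rho> x]]
      has_real_derivative_partial[OF smooth_up_to_boundaryD(2)[OF P x]]
    have "((\<lambda>t. F (partial i u) (x + t *\<^sub>R axis i 1)) has_real_derivative d i x) (at 0)"
      unfolding F_def d_def sum_2
      by (rule derivative_eq_intros D refl zero_neq_numeral[symmetric])+ (simp add: algebra_simps power2_eq_square)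
    then show ?thesis
    proof (rule has_field_derivative_transform_within_open)
      show "open ((\<lambda>t. x + t *\<^sub>R axis i 1) -` S)"
        by (intro open_vimage S continuous_intros)
    qed (use x v in \<open>auto simp: F_def\<close>)
  qed
  \<comment> \<open>The remaining premise, that the flux vanishes on the frontier, holds because
    each of its terms contains a component of \<open>u\<close> as a factor.\<close>
  note * = integral_directional_derivative_eq_0[OF S contF _ deriv bound]
  show "integrable lborel (\<lambda>x. indicator S x * d i x)" by (rule *) (simp_all add: F_def u0)
  show "(\<integral>x. indicator S x * d i x \<partial>lborel) = 0" by (rule *) (simp_all add: F_def u0)
qed

theorem lemma1p1:
  fixes \<Omega> :: "(real^2) set" and \<nu> :: real and f \<rho> P :: "real^2 \<Rightarrow> real"
    and u :: "real^2 \<Rightarrow> real^2"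
  assumes "bounded_smooth_domain \<Omega>"
    and "\<nu> > 0"
    and "smooth_up_to_boundary \<Omega> f" and "\<And>x. x \<in> \<Omega> \<Longrightarrow> f x > 0"
    and "smooth_up_to_boundary \<Omega> u"
    and "smooth_up_to_boundary \<Omega> \<rho>"
    and "smooth_up_to_boundary \<Omega> P"
    and "steady_inhomogeneous_NS \<Omega> \<nu> f u \<rho> P"
  shows "hydrostatic_equilibrium \<Omega> f u \<rho> P"
proof -
  have \<Omega>: "\<Omega> \<noteq> {}" "open \<Omega>" "connected \<Omega>" "bounded \<Omega>"
    using assms(1) by (auto simp: bounded_smooth_domain_def)
  have momentum: "\<rho> x *\<^sub>R advect u u x = \<nu> *\<^sub>R laplacian u x - grad P x - \<rho> x *\<^sub>R grad f x"
    and transport: "advect u \<rho> x = 0" and incompressible: "div_field u x = 0" if "x \<in> \<Omega>" for x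
    using assms(8) that by (auto simp: steady_inhomogeneous_NS_def)
  have u0: "u x = 0" if "x \<in> frontier \<Omega>" for x
    using assms(8) that by (auto simp: steady_inhomogeneous_NS_def)
  \<comment> \<open>The same expression as in the flux lemma, so that its conclusions can be folded
    into \<open>d\<close>.\<close>
  define d where "d i x =
      \<nu> * (\<Sum>j\<in>UNIV. (partial i u x $ j)\<^sup>2 + u x $ j * partial i (partial i u) x $ j)
      - (partial i P x + partial i \<rho> x * (f x + (\<Sum>j\<in>UNIV. (u x $ j)\<^sup>2) / 2)
          + \<rho> x * (partial i f x + (\<Sum>j\<in>UNIV. u x $ j * partial i u x $ j))) * u x $ i
      - (P x + \<rho> x * (f x + (\<Sum>j\<in>UNIV. (u x $ j)\<^sup>2) / 2)) * partial i u x $ i" for i x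
  note flux = integral_energy_flux_eq_0[OF \<Omega>(2,4) assms(3,5,6,7) u0, of \<nu>, folded d_def]
  \<comment> \<open>The density of viscous dissipation.\<close>
  define E where "E x = \<nu> * (\<Sum>i\<in>UNIV. \<Sum>j\<in>UNIV. (partial i u x $ j)\<^sup>2)" for x
  have dE: "(\<Sum>i\<in>UNIV. d i x) = E x" if x: "x \<in> \<Omega>" for x
  proof -
    have m: "\<rho> x * (u x $ 1 * partial 1 u x $ j + u x $ 2 * partial 2 u x $ j)
        = \<nu> * (partial 1 (partial 1 u) x $ j + partial 2 (partial 2 u) x $ j)
          - partial j P x - \<rho> x * partial j f x" for j
      using arg_cong[OF momentum[OF x], of "\<lambda>y. y $ j"]
      by (simp add: advect_def laplacian_def grad_def sum_2)
    have r: "u x $ 1 * partial 1 \<rho> x + u x $ 2 * partial 2 \<rho> x = 0"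
      using transport[OF x] by (simp add: advect_def sum_2)
    have i: "partial 1 u x $ 1 + partial 2 u x $ 2 = 0"
      using incompressible[OF x] by (simp add: div_field_def sum_2)
    \<comment> \<open>The combination is \<open>m j\<close> times \<open>u x $ j\<close> summed over
      \<open>j\<close>, the transport equation times \<open>f + |u|^2 / 2\<close>, and the
      divergence equation times the Bernoulli-type factor \<open>P + \<rho> (f + |u|^2 / 2)\<close>.
      Only the squared first derivatives survive.\<close>
    show ?thesis
      unfolding d_def E_def sum_2 using m[of 1] m[of 2] r i by algebra
  qed
  have E: "integrable lborel (\<lambda>x. indicator \<Omega> x * E x)" "(\<integral>x. indicator \<Omega> x * E x \<partial>lborel) = 0"
  proof -
    have *: "(\<lambda>x. indicator \<Omega> x * E x) = (\<lambda>x. \<Sum>i\<in>UNIV. indicator \<Omega> x * d i x)"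
      using dE by (auto simp flip: sum_distrib_left split: split_indicator)
    show "integrable lborel (\<lambda>x. indicator \<Omega> x * E x)"
      unfolding * using flux(1) by (intro Bochner_Integration.integrable_sum)
    show "(\<integral>x. indicator \<Omega> x * E x \<partial>lborel) = 0"
      unfolding * using flux by (subst Bochner_Integration.integral_sum) auto
  qed
  have "E x = 0" if "x \<in> \<Omega>" for x
  proof (rule continuous_eq_0_if_integral_eq_0[OF \<Omega>(2) _ _ E that])
    have "continuous_on \<Omega> (partial i u)" for i
      using smooth_up_to_boundaryD(3)[OF assms(5)]
      by (simp add: continuous_at_imp_continuous_on differentiable_imp_continuous_within)
    then show "continuous_on \<Omega> E" unfolding E_def by (intro continuous_intros) auto
    show "0 \<le> E x" for x
      unfolding E_def using assms(2) by (intro mult_nonneg_nonneg sum_nonneg) auto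
  qed
  then have grad0: "partial i u x = 0" if "x \<in> \<Omega>" for x i
    using that assms(2) by (simp add: E_def sum_nonneg_eq_0_iff sum_nonneg vec_eq_iff)
  obtain x0 where x0: "x0 \<in> \<Omega>" using \<Omega>(1) by blast
  define c where "c = u x0"
  have c: "u x = c" if "x \<in> \<Omega>" for x
    unfolding c_def
  proof (rule has_derivative_zero_unique_connected[OF \<Omega>(2,3) _ that x0])
    show "(u has_derivative (\<lambda>_. 0)) (at y)" if "y \<in> \<Omega>" for y
      using that by (intro has_derivative_0_if_partial_eq_0 grad0 smooth_up_to_boundaryD(2)[OF assms(5)])
  qed
  have closure_c: "u x = c" if "x \<in> closure \<Omega>" for x
    by (rule continuous_constant_on_closure[OF smooth_up_to_boundaryD(1)[OF assms(5)] c that])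
  \<comment> \<open>A nonempty bounded set is not the whole plane, so there is a boundary point, at
    which the constant must equal the no-slip value 0.\<close>
  have "frontier \<Omega> \<noteq> {}"
    using \<Omega>(1,4) not_bounded_UNIV by (auto simp: frontier_eq_empty)
  then obtain p where p: "p \<in> frontier \<Omega>" by blast
  then have "c = 0" using closure_c[of p] u0[of p] by (simp add: frontier_def)
  then have uzero: "u x = 0" if "x \<in> closure \<Omega>" for x using closure_c that by simp
  moreover have "grad P x = - (\<rho> x *\<^sub>R grad f x)" if x: "x \<in> \<Omega>" for x
  proof -
    \<comment> \<open>The first derivatives vanish on the whole open set, not just at
      \<open>x\<close>, so they can be differentiated again.\<close>
    have "partial i (partial i u) x = 0" for i
      by (rule partial_eq_0_if_zero_on_open[OF \<Omega>(2) x grad0])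
    then have "laplacian u x = 0" by (simp add: laplacian_def)
    moreover have "advect u u x = 0" using grad0[OF x] by (simp add: advect_def)
    ultimately have "- grad P x - \<rho> x *\<^sub>R grad f x = 0" using momentum[OF x] by simp
    \<comment> \<open>Adding a vector known to be 0 lets the pressure gradient cancel, leaving the
      hydrostatic form.\<close>
    then have "grad P x = grad P x + (- grad P x - \<rho> x *\<^sub>R grad f x)" by simp
    then show ?thesis by simp
  qed
  ultimately show ?thesis by (simp add: hydrostatic_equilibrium_def)
qed

end
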